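(* Let $X$ be a finite set of alternatives with $|X|=m>3$ and $N=\{1,2,3\}$ (so $n=3$). If $G$ is a scoring social choice correspondence (for some scoring system $s_1\leq s_2\leq\cdots\leq s_m$ of real weights with at least two weights distinct) and $G$ satisfies balancedness, then $G$ is the Borda correspondence, i.e. $G(u)=G_B(u)$ for every profile $u$.
   Context: An ordering on $X$ is a strict linear order on $X$; $L(X)$ is the set of all orderings; $r[k]$ is the $k$-th ranked alternative of ordering $r$. A profile is $u=(u(1),\dots,u(n))\in L(X)^N$. Given weights $s_1\leq\cdots\leq s_m$, the score of $x$ at $u$ is $S(x,u)=\sum_{i=1}^n s(u,i,x)$ with $s(u,i,x)=s_k$ if $u(i)[k]=x$; the scoring social choice correspondence selects at $u$ the alternatives with the lowest score. The Borda correspondence $G_B$ is the scoring social choice correspondence with weights $1<2<\cdots<m$. Profile $v$ is constructed from $u$ by transposition pair $(x,y)$ via individuals $i$ and $j$ if at $u$, $x$ is immediately above $y$ in $u(i)$ and $y$ is immediately above $x$ in $u(j)$, and $v$ equals $u$ except that $x$ and $y$ are swapped in the orderings of $i$ and $j$. $G$ satisfies balancedness if $G(v)=G(u)$ whenever $v$ is constructed from $u$ by some transposition pair via some two individuals. *)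

theory Defs
  imports Complex_Main "HOL-Library.FuncSet" "HOL-Combinatorics.Transposition"
begin

text \<open>An ordering is a relation \<^term>\<open>r\<close> in which \<^term>\<open>(x, y) \<in> r\<close> means that \<^term>\<open>x\<close> is ranked
  strictly above \<^term>\<open>y\<close>. The inclusion in \<^term>\<open>X \<times> X\<close> is needed because
  \<^const>\<open>strict_linear_order_on\<close> does not restrict the field of the relation.\<close>

definition orderings :: "'a set \<Rightarrow> 'a rel set" where
  "orderings X = {r. r \<subseteq> X \<times> X \<and> strict_linear_order_on X r}"

text \<open>Ranks count from 1 (top) to \<^term>\<open>card X\<close> (bottom).\<close>

definition ranked :: "'a set \<Rightarrow> 'a rel \<Rightarrow> nat \<Rightarrow> 'a" where
  "ranked X r k = (THE x. x \<in> X \<and> card {y \<in> X. (y, x) \<in> r} + 1 = k)"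

definition profiles :: "'a set \<Rightarrow> 'i set \<Rightarrow> ('i \<Rightarrow> 'a rel) set" where
  "profiles X N = (N \<rightarrow>\<^sub>E orderings X)"

text \<open>Only the values \<^term>\<open>s k\<close> for \<^term>\<open>k \<in> {1..m}\<close> are meaningful.\<close>

definition scoring_system :: "nat \<Rightarrow> (nat \<Rightarrow> real) \<Rightarrow> bool" where
  "scoring_system m s \<longleftrightarrow>
     (\<forall>k\<in>{1..m}. \<forall>l\<in>{1..m}. k \<le> l \<longrightarrow> s k \<le> s l) \<and>
     (\<exists>k\<in>{1..m}. \<exists>l\<in>{1..m}. s k \<noteq> s l)"

definition individual_score ::
    "'a set \<Rightarrow> (nat \<Rightarrow> real) \<Rightarrow> ('i \<Rightarrow> 'a rel) \<Rightarrow> 'i \<Rightarrow> 'a \<Rightarrow> real" where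
  "individual_score X s u i x = s (THE k. k \<in> {1..card X} \<and> ranked X (u i) k = x)"

definition score ::
    "'a set \<Rightarrow> 'i set \<Rightarrow> (nat \<Rightarrow> real) \<Rightarrow> 'a \<Rightarrow> ('i \<Rightarrow> 'a rel) \<Rightarrow> real" where
  "score X N s x u = (\<Sum>i\<in>N. individual_score X s u i x)"

definition scoring_choice ::
    "'a set \<Rightarrow> 'i set \<Rightarrow> (nat \<Rightarrow> real) \<Rightarrow> ('i \<Rightarrow> 'a rel) \<Rightarrow> 'a set" where
  "scoring_choice X N s u = {x \<in> X. \<forall>y\<in>X. score X N s x u \<le> score X N s y u}"

definition is_scoring_correspondence ::
    "'a set \<Rightarrow> 'i set \<Rightarrow> (('i \<Rightarrow> 'a rel) \<Rightarrow> 'a set) \<Rightarrow> bool" where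
  "is_scoring_correspondence X N G \<longleftrightarrow>
     (\<exists>s. scoring_system (card X) s \<and> (\<forall>u\<in>profiles X N. G u = scoring_choice X N s u))"

definition borda :: "'a set \<Rightarrow> 'i set \<Rightarrow> ('i \<Rightarrow> 'a rel) \<Rightarrow> 'a set" where
  "borda X N = scoring_choice X N (\<lambda>k. real k)"

definition immediately_above :: "'a rel \<Rightarrow> 'a \<Rightarrow> 'a \<Rightarrow> bool" where
  "immediately_above r x y \<longleftrightarrow> (x, y) \<in> r \<and> \<not> (\<exists>z. (x, z) \<in> r \<and> (z, y) \<in> r)"

definition swap_alternatives :: "'a \<Rightarrow> 'a \<Rightarrow> 'a rel \<Rightarrow> 'a rel" where
  "swap_alternatives x y r = map_prod (transpose x y) (transpose x y) ` r"

text \<open>The two individuals are automatically distinct, by asymmetry of orderings.\<close>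

definition by_transposition_pair ::
    "('i \<Rightarrow> 'a rel) \<Rightarrow> ('i \<Rightarrow> 'a rel) \<Rightarrow> 'a \<Rightarrow> 'a \<Rightarrow> 'i \<Rightarrow> 'i \<Rightarrow> bool" where
  "by_transposition_pair v u x y i j \<longleftrightarrow>
     immediately_above (u i) x y \<and> immediately_above (u j) y x \<and>
     v = u(i := swap_alternatives x y (u i), j := swap_alternatives x y (u j))"

definition balanced ::
    "'a set \<Rightarrow> 'i set \<Rightarrow> (('i \<Rightarrow> 'a rel) \<Rightarrow> 'a set) \<Rightarrow> bool" where
  "balanced X N G \<longleftrightarrow>
     (\<forall>u\<in>profiles X N. \<forall>v\<in>profiles X N. \<forall>x\<in>X. \<forall>y\<in>X. \<forall>i\<in>N. \<forall>j\<in>N.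
        by_transposition_pair v u x y i j \<longrightarrow> G v = G u)"

end

theory Submission
  imports Defs
begin

text \<open>A positive affine change of the weights does not affect the choice, so it suffices that all
  consecutive gaps of the weights agree. If two alternatives are both chosen at a profile, then
  balancedness keeps both chosen, hence tied, after a transposition pair; if only one of them takes
  part in the transposition, this forces the two gaps involved to be equal. Assuming that the
  first \<open>h \<ge> 2\<close> gaps agree, a profile with such a tie exists in which the transposition
  uses the first and the next gap. The first three gaps need two special profiles in which only
  four alternatives matter.\<close>

section \<open>Orderings encoded by position functions\<close>

definition order_of :: "'a set \<Rightarrow> ('a \<Rightarrow> nat) \<Rightarrow> 'a rel" where
  "order_of X p = {(a, b). a \<in> X \<and> b \<in> X \<and> p a < p b}"

text \<open>The 0-based rank of \<open>x\<close>; \<open>ranked\<close> counts from 1, hence the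
  \<open>Suc\<close> in the score formulas.\<close>

definition num_above :: "'a set \<Rightarrow> 'a rel \<Rightarrow> 'a \<Rightarrow> nat" where
  "num_above X r x = card {y \<in> X. (y, x) \<in> r}"

lemma order_of_in_orderings:
  assumes "inj_on p X"
  shows "order_of X p \<in> orderings X"
  using assms unfolding orderings_def order_of_def strict_linear_order_on_def
  by (auto simp: trans_on_def irrefl_on_def total_on_def inj_on_def)
    (metis linorder_neqE_nat)

lemma num_above_order_of:
  assumes p: "bij_betw p X {..<card X}" and x: "x \<in> X"
  shows "num_above X (order_of X p) x = p x"
proof -
  have "p x < card X" and "p ` X = {..<card X}"
    using p x unfolding bij_betw_def by auto
  then have "p ` {y \<in> X. p y < p x} = {..<p x}"
    by (safe, auto)
  moreover have "inj_on p {y \<in> X. p y < p x}"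
    using p by (auto simp: bij_betw_def inj_on_def)
  ultimately have "card {y \<in> X. p y < p x} = p x"
    using card_image[of p "{y \<in> X. p y < p x}"] by simp
  then show ?thesis
    using x unfolding num_above_def order_of_def by simp
qed

text \<open>Transitivity and irreflexivity make the count grow strictly down the ordering, totality
  turns this into injectivity, and counting gives surjectivity.\<close>

lemma bij_betw_num_above:
  assumes "finite X" "r \<in> orderings X"
  shows "bij_betw (num_above X r) X {..<card X}"
proof -
  have r: "trans r" "irrefl r" "total_on X r"
    using assms(2) unfolding orderings_def strict_linear_order_on_def by auto
  have mono: "num_above X r x < num_above X r y" if "(x, y) \<in> r" "x \<in> X" for x y
    unfolding num_above_def
  proof (rule psubset_card_mono)
    show "{z \<in> X. (z, x) \<in> r} \<subset> {z \<in> X. (z, y) \<in> r}"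
      using that r(1,2) unfolding trans_def irrefl_def by blast
  qed (use assms in auto)
  have inj: "inj_on (num_above X r) X"
  proof (rule inj_onI, rule ccontr)
    fix x y assume "x \<in> X" "y \<in> X" "num_above X r x = num_above X r y" "x \<noteq> y"
    then show False
      using r(3) mono[of x y] mono[of y x] unfolding total_on_def by fastforce
  qed
  have "num_above X r x < card X" if "x \<in> X" for x
    unfolding num_above_def
  proof (rule psubset_card_mono)
    show "{z \<in> X. (z, x) \<in> r} \<subset> X"
      using that r(2) unfolding irrefl_def by blast
  qed (use assms in auto)
  then have "num_above X r ` X \<subseteq> {..<card X}"
    by auto
  then have "num_above X r ` X = {..<card X}"
    using card_image[OF inj] by (intro card_subset_eq) auto
  with inj show ?thesis
    unfolding bij_betw_def by blast
qed

text \<open>Eliminates the definite descriptions in \<open>ranked\<close> and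
  \<open>individual_score\<close>; bijectivity of \<open>num_above\<close> gives existence and
  uniqueness for each.\<close>

lemma individual_score_eq:
  assumes "finite X" "u i \<in> orderings X" "x \<in> X"
  shows "individual_score X s u i x = s (Suc (num_above X (u i) x))"
proof -
  note b = bij_betw_num_above[OF assms(1,2)]
  have inj: "num_above X (u i) a = num_above X (u i) c \<longleftrightarrow> a = c" if "a \<in> X" "c \<in> X" for a c
    using b that unfolding bij_betw_def by (meson inj_on_eq_iff)
  have ranked: "ranked X (u i) k = x \<longleftrightarrow> k = Suc (num_above X (u i) x)"
    if k: "k \<in> {1..card X}" for k
  proof -
    have "k - 1 \<in> {..<card X}"
      using k by auto
    then obtain z where z: "z \<in> X" "num_above X (u i) z = k - 1"
      using b unfolding bij_betw_def by (metis imageE)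
    have kz: "k = num_above X (u i) z + 1"
      using z(2) k by simp
    have "(w \<in> X \<and> num_above X (u i) w + 1 = k) \<longleftrightarrow> w = z" for w
      unfolding kz using z(1) inj by (metis add_right_cancel)
    then have "ranked X (u i) k = z"
      unfolding ranked_def num_above_def[symmetric] by simp
    then show ?thesis
      unfolding kz using inj[OF z(1) assms(3)] by simp
  qed
  have "num_above X (u i) x < card X"
    using b assms(3) unfolding bij_betw_def by auto
  then have "(THE k. k \<in> {1..card X} \<and> ranked X (u i) k = x) = Suc (num_above X (u i) x)"
    using ranked by (intro the_equality) auto
  then show ?thesis
    unfolding individual_score_def by simp
qed

lemma individual_score_order_of:
  assumes "finite X" "bij_betw p X {..<card X}" "u i = order_of X p" "x \<in> X"
  shows "individual_score X s u i x = s (Suc (p x))"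
proof -
  have "u i \<in> orderings X"
    using assms(2,3) order_of_in_orderings unfolding bij_betw_def by metis
  then show ?thesis
    using assms by (simp add: individual_score_eq num_above_order_of)
qed

text \<open>The transposition is its own inverse, so taking the image of the relation amounts to
  precomposing the position function.\<close>

lemma swap_alternatives_order_of:
  assumes "x \<in> X" "y \<in> X"
  shows "swap_alternatives x y (order_of X p) = order_of X (p \<circ> transpose x y)"
proof -
  have tX: "transpose x y a \<in> X \<longleftrightarrow> a \<in> X" for a
    using assms by (auto simp: transpose_def)
  have "(a, b) \<in> swap_alternatives x y (order_of X p) \<longleftrightarrow>
      (transpose x y a, transpose x y b) \<in> order_of X p" for a b
    unfolding swap_alternatives_def
    by (auto intro!: image_eqI[where x = "(transpose x y a, transpose x y b)"])
  then show ?thesis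
    by (auto simp: order_of_def tX)
qed

section \<open>Balancedness for position functions\<close>

definition minimizers :: "'a set \<Rightarrow> ('a \<Rightarrow> real) \<Rightarrow> 'a set" where
  "minimizers A f = {x \<in> A. \<forall>y\<in>A. f x \<le> f y}"

lemma scoring_choice_order_of:
  assumes "finite X" "\<And>i. i \<in> N \<Longrightarrow> bij_betw (p i) X {..<card X}"
    and "\<And>i. i \<in> N \<Longrightarrow> u i = order_of X (p i)"
  shows "scoring_choice X N s u = minimizers X (\<lambda>x. \<Sum>i\<in>N. s (Suc (p i x)))"
proof -
  have "score X N s x u = (\<Sum>i\<in>N. s (Suc (p i x)))" if "x \<in> X" for x
    unfolding score_def using assms that by (intro sum.cong) (auto simp: individual_score_order_of)
  then show ?thesis
    unfolding scoring_choice_def minimizers_def by auto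
qed

text \<open>Neighbouring positions in opposite order in \<open>p\<close> and \<open>q\<close> yield
  a transposition pair via individuals 1 and 2, while individual 3 keeps \<open>r\<close>.\<close>

lemma minimizers_swap_eq:
  assumes X: "finite X" and G: "\<forall>u\<in>profiles X {1, 2, 3}. G u = scoring_choice X {1, 2, 3} s u"
    and bal: "balanced X {1, 2, 3 :: nat} G"
    and bij: "bij_betw p X {..<card X}" "bij_betw q X {..<card X}" "bij_betw r X {..<card X}"
    and xy: "x \<in> X" "y \<in> X" "p y = Suc (p x)" "q x = Suc (q y)"
  shows "minimizers X (\<lambda>a. s (Suc (p a)) + s (Suc (q a)) + s (Suc (r a))) =
    minimizers X (\<lambda>a. s (Suc (p (transpose x y a))) + s (Suc (q (transpose x y a))) + s (Suc (r a)))"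
proof -
  let ?N = "{1, 2, 3 :: nat}" and ?t = "transpose x y"
  define P where "P = (\<lambda>i::nat. if i = 1 then p else if i = 2 then q else r)"
  define Q where "Q = (\<lambda>i::nat. if i = 1 then p \<circ> ?t else if i = 2 then q \<circ> ?t else r)"
  define u where "u = (\<lambda>i\<in>?N. order_of X (P i))"
  define v where "v = (\<lambda>i\<in>?N. order_of X (Q i))"
  have t: "bij_betw ?t X X"
    using xy(1,2) by (auto intro!: bij_betw_byWitness[where f' = ?t] simp: transpose_def)
  have P: "bij_betw (P i) X {..<card X}" and Q: "bij_betw (Q i) X {..<card X}" for i
    using bij bij_betw_trans[OF t] by (auto simp: P_def Q_def)
  have uv: "u \<in> profiles X ?N" "v \<in> profiles X ?N"
    using P Q unfolding profiles_def u_def v_def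
    by (auto simp: bij_betw_def intro!: order_of_in_orderings)
  have "immediately_above (u 1) x y" "immediately_above (u 2) y x"
    using xy by (auto simp: immediately_above_def u_def P_def order_of_def)
  moreover have "v = u(1 := swap_alternatives x y (u 1), 2 := swap_alternatives x y (u 2))"
    using xy by (auto simp: v_def u_def P_def Q_def swap_alternatives_order_of fun_eq_iff)
  ultimately have "by_transposition_pair v u x y 1 2"
    unfolding by_transposition_pair_def by blast
  with bal uv xy have "G v = G u"
    unfolding balanced_def by blast
  with G uv have "scoring_choice X ?N s u = scoring_choice X ?N s v"
    by simp
  then have "minimizers X (\<lambda>a. \<Sum>i\<in>?N. s (Suc (P i a))) = minimizers X (\<lambda>a. \<Sum>i\<in>?N. s (Suc (Q i a)))"
    using scoring_choice_order_of[OF X, where N = ?N and p = P and u = u and s = s]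
      scoring_choice_order_of[OF X, where N = ?N and p = Q and u = v and s = s] P Q
    by (simp add: u_def v_def)
  then show ?thesis
    by (simp add: P_def Q_def add.assoc)
qed

text \<open>Here alternatives are numbered from 0, \<open>p\<close>, \<open>q\<close>, \<open>r\<close> are the 0-based positions in the three
  orderings and \<open>t j\<close> is the weight of position \<open>j\<close>.\<close>

definition swap_invariant :: "nat \<Rightarrow> (nat \<Rightarrow> real) \<Rightarrow> bool" where
  "swap_invariant m t \<longleftrightarrow> (\<forall>p q r x y.
     inj_on p {..<m} \<and> inj_on q {..<m} \<and> inj_on r {..<m} \<and>
     p ` {..<m} \<subseteq> {..<m} \<and> q ` {..<m} \<subseteq> {..<m} \<and> r ` {..<m} \<subseteq> {..<m} \<and>
     x < m \<and> y < m \<and> p y = Suc (p x) \<and> q x = Suc (q y) \<longrightarrow>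
     minimizers {..<m} (\<lambda>j. t (p j) + t (q j) + t (r j)) =
     minimizers {..<m} (\<lambda>j. t (p (transpose x y j)) + t (q (transpose x y j)) + t (r j)))"

text \<open>Everything is transported along a bijection \<open>f\<close> from \<open>X\<close> to an
  initial segment, so that later profiles can be given by explicit numbers.\<close>

lemma balanced_imp_swap_invariant:
  assumes X: "finite X" and G: "\<forall>u\<in>profiles X {1, 2, 3}. G u = scoring_choice X {1, 2, 3} s u"
    and bal: "balanced X {1, 2, 3 :: nat} G"
  shows "swap_invariant (card X) (\<lambda>j. s (Suc j))"
  unfolding swap_invariant_def
proof (intro allI impI, elim conjE)
  fix p q r :: "nat \<Rightarrow> nat" and x y
  let ?M = "{..<card X}"
  assume inj: "inj_on p ?M" "inj_on q ?M" "inj_on r ?M"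
    and img: "p ` ?M \<subseteq> ?M" "q ` ?M \<subseteq> ?M" "r ` ?M \<subseteq> ?M"
    and xy: "x < card X" "y < card X" "p y = Suc (p x)" "q x = Suc (q y)"
  obtain f where f: "bij_betw f X ?M"
    using X ex_bij_betw_finite_nat by (metis atLeast0LessThan)
  define e where "e = inv_into X f"
  have e: "bij_betw e ?M X" and fe: "\<And>j. j < card X \<Longrightarrow> f (e j) = j"
    using f bij_betw_inv_into bij_betw_inv_into_right unfolding e_def by fastforce+
  have eX: "e j \<in> X" if "j < card X" for j
    using e that unfolding bij_betw_def by auto
  have bij: "bij_betw (g \<circ> f) X ?M" if "inj_on g ?M" "g ` ?M \<subseteq> ?M" for g
  proof -
    \<comment> \<open>An injective self-map of a finite set is onto.\<close>
    have "bij_betw g ?M ?M"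
      using that endo_inj_surj[of ?M g] unfolding bij_betw_def by simp
    with f show ?thesis
      by (rule bij_betw_trans)
  qed
  have tr: "f (transpose (e x) (e y) (e j)) = transpose x y j" if "j < card X" for j
    using that xy fe by (auto simp: transpose_def) (metis fe)+
  have pull: "minimizers ?M (\<lambda>j. g (e j)) = {j \<in> ?M. e j \<in> minimizers X g}" for g
  proof -
    have "X = e ` ?M"
      using e unfolding bij_betw_def by simp
    then have "(\<forall>y\<in>X. P y) \<longleftrightarrow> (\<forall>j\<in>?M. P (e j))" for P
      by (metis ball_simps(9))
    then show ?thesis
      using eX unfolding minimizers_def by auto
  qed
  have cong: "minimizers ?M g = minimizers ?M h" if "\<And>j. j < card X \<Longrightarrow> g j = h j" for g h
    using that unfolding minimizers_def by auto
  let ?S = "\<lambda>a. s (Suc ((p \<circ> f) a)) + s (Suc ((q \<circ> f) a)) + s (Suc ((r \<circ> f) a))"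
  let ?T = "\<lambda>a. s (Suc ((p \<circ> f) (transpose (e x) (e y) a))) +
    s (Suc ((q \<circ> f) (transpose (e x) (e y) a))) + s (Suc ((r \<circ> f) a))"
  have eq: "minimizers X ?S = minimizers X ?T"
    by (rule minimizers_swap_eq[OF X G bal bij[OF inj(1) img(1)] bij[OF inj(2) img(2)] bij[OF inj(3) img(3)]])
      (use xy eX fe in simp_all)
  have "minimizers ?M (\<lambda>j. ?S (e j)) = minimizers ?M (\<lambda>j. ?T (e j))"
    by (simp only: pull[of ?S] pull[of ?T] eq)
  moreover have "minimizers ?M (\<lambda>j. ?S (e j)) =
      minimizers ?M (\<lambda>j. s (Suc (p j)) + s (Suc (q j)) + s (Suc (r j)))"
    by (rule cong) (simp add: fe)
  moreover have "minimizers ?M (\<lambda>j. ?T (e j)) = minimizers ?M (\<lambda>j. s (Suc (p (transpose x y j))) +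
      s (Suc (q (transpose x y j))) + s (Suc (r j)))"
    by (rule cong) (simp add: fe tr)
  ultimately show "minimizers ?M (\<lambda>j. s (Suc (p j)) + s (Suc (q j)) + s (Suc (r j))) =
    minimizers ?M (\<lambda>j. s (Suc (p (transpose x y j))) + s (Suc (q (transpose x y j))) + s (Suc (r j)))"
    by simp
qed

lemma swap_invariantD:
  assumes "swap_invariant m t"
    and "inj_on p {..<m}" "inj_on q {..<m}" "inj_on r {..<m}"
    and "p ` {..<m} \<subseteq> {..<m}" "q ` {..<m} \<subseteq> {..<m}" "r ` {..<m} \<subseteq> {..<m}"
    and "x < m" "y < m" "p y = Suc (p x)" "q x = Suc (q y)"
  shows "minimizers {..<m} (\<lambda>j. t (p j) + t (q j) + t (r j)) =
    minimizers {..<m} (\<lambda>j. t (p (transpose x y j)) + t (q (transpose x y j)) + t (r j))"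
  using assms unfolding swap_invariant_def by blast

section \<open>Comparing gaps of the weights\<close>

lemma tied_minimizers:
  assumes "a \<in> minimizers A f" "b \<in> minimizers A f"
  shows "f a = f b"
  using assms unfolding minimizers_def by (auto intro: antisym)

text \<open>In the two special profiles every alternative from 4 on has its own number as position
  in all orderings, so one uniform bound covers them.\<close>

lemma minimizers_lessThanI:
  fixes f :: "nat \<Rightarrow> real"
  assumes "a < m" "f a \<le> f 0" "f a \<le> f 1" "f a \<le> f 2" "f a \<le> f 3"
    and "\<And>i. \<lbrakk>4 \<le> i; i < m\<rbrakk> \<Longrightarrow> f a \<le> f i"
  shows "a \<in> minimizers {..<m} f"
proof -
  have "f a \<le> f i" if "i < m" for i
  proof -
    consider "i = 0" | "i = 1" | "i = 2" | "i = 3" | "4 \<le> i"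
      by linarith
    then show ?thesis
      using assms(2-5) assms(6)[OF _ that] by cases simp_all
  qed
  then show ?thesis
    using assms(1) unfolding minimizers_def by simp
qed

text \<open>Alternatives are numbered by their position in the first ordering. The other two orderings list
  1, 3, 2, 0 and 2, 0, 3, 1 at the top; alternatives 2 and 3 are transposed.\<close>

lemma second_gap_eq_third:
  assumes m: "3 < m" and mono: "\<And>i j. \<lbrakk>i \<le> j; j < m\<rbrakk> \<Longrightarrow> t i \<le> t j" and inv: "swap_invariant m t"
  shows "t 2 - t 1 = t 3 - t (2::nat)"
proof -
  define q :: "nat \<Rightarrow> nat"
    where "q = (\<lambda>j. if j = 0 then 3 else if j = 1 then 0 else if j = 3 then 1 else j)"
  define r :: "nat \<Rightarrow> nat"
    where "r = (\<lambda>j. if j = 0 then 1 else if j = 1 then 3 else if j = 2 then 0 else if j = 3 then 2 else j)"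
  define f where "f = (\<lambda>j. t j + t (q j) + t (r j))"
  define g where "g = (\<lambda>j. t (transpose 2 3 j) + t (q (transpose 2 3 j)) + t (r j))"
  have eq: "minimizers {..<m} f = minimizers {..<m} g"
    unfolding f_def g_def using m
    by (intro swap_invariantD[OF inv, where p = "\<lambda>j. j"]) (auto simp: inj_on_def q_def r_def)
  have f: "f 0 = t 0 + t 1 + t 3" "f 1 = t 0 + t 1 + t 3" "f 2 = t 0 + 2 * t 2" "f 3 = t 1 + t 2 + t 3"
    by (simp_all add: f_def q_def r_def)
  have g: "g 0 = t 0 + t 1 + t 3" "g 1 = t 0 + t 1 + t 3" "g 2 = t 0 + t 1 + t 3" "g 3 = 3 * t 2"
    by (simp_all add: g_def q_def r_def transpose_def)
  have small: "t 0 \<le> t 1" "t 1 \<le> t 2" "t 2 \<le> t 3"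
    using m by (auto intro!: mono)
  have big: "3 * t 3 \<le> f i" "f i = g i" if "4 \<le> i" "i < m" for i
    using mono[of 3 i] that by (simp_all add: f_def g_def q_def r_def transpose_def)
  \<comment> \<open>Case 1: 2 is chosen before the swap, hence after it, where it ties with 1; so 1
    is chosen before as well, although 2 beats it there. Case 2: 2 is chosen after the swap, hence
    before it, where 1 beats it.\<close>
  consider "2 * t 2 < t 1 + t 3" | "2 * t 2 > t 1 + t 3" | "2 * t 2 = t 1 + t 3"
    by linarith
  then show ?thesis
  proof cases
    case 1
    have "2 \<in> minimizers {..<m} f"
    proof (rule minimizers_lessThanI)
      show "f 2 \<le> f i" if "4 \<le> i" "i < m" for i
        using big(1)[OF that] 1 f small by linarith
    qed (use 1 f small m in linarith)+
    then have "2 \<in> minimizers {..<m} g"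
      using eq by simp
    then have "1 \<in> minimizers {..<m} g"
      using m g unfolding minimizers_def by simp
    then have "1 \<in> minimizers {..<m} f"
      using eq by simp
    then have "f 1 \<le> f 2"
      using m unfolding minimizers_def by simp
    with 1 f show ?thesis
      by simp
  next
    case 2
    have "2 \<in> minimizers {..<m} g"
    proof (rule minimizers_lessThanI)
      show "g 2 \<le> g i" if "4 \<le> i" "i < m" for i
        using big[OF that] 2 g small by linarith
    qed (use 2 g small m in linarith)+
    then have "2 \<in> minimizers {..<m} f"
      using eq by simp
    then have "f 2 \<le> f 1"
      using m unfolding minimizers_def by simp
    with 2 f show ?thesis
      by simp
  qed simp
qed

text \<open>The second and third orderings list 2, 1, 3, 0 and 3, 0, 1, 2 at the top; alternatives 1 and 2
  are transposed, after which 0 and 1 tie because the second and third gaps agree.\<close>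

lemma first_gap_eq_second:
  assumes m: "3 < m" and mono: "\<And>i j. \<lbrakk>i \<le> j; j < m\<rbrakk> \<Longrightarrow> t i \<le> t j" and inv: "swap_invariant m t"
  shows "t 1 - t 0 = t 2 - t (1::nat)"
proof -
  define q :: "nat \<Rightarrow> nat"
    where "q = (\<lambda>j. if j = 0 then 3 else if j = 2 then 0 else if j = 3 then 2 else j)"
  define r :: "nat \<Rightarrow> nat"
    where "r = (\<lambda>j. if j = 0 then 1 else if j = 1 then 2 else if j = 2 then 3 else if j = 3 then 0 else j)"
  define f where "f = (\<lambda>j. t j + t (q j) + t (r j))"
  define g where "g = (\<lambda>j. t (transpose 1 2 j) + t (q (transpose 1 2 j)) + t (r j))"
  have eq: "minimizers {..<m} f = minimizers {..<m} g"
    unfolding f_def g_def using m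
    by (intro swap_invariantD[OF inv, where p = "\<lambda>j. j"]) (auto simp: inj_on_def q_def r_def)
  have t3: "t 3 = 2 * t 2 - t 1"
    using second_gap_eq_third[OF m mono inv] by simp
  have f: "f 0 = t 0 + 2 * t 2" "f 1 = 2 * t 1 + t 2"
    using t3 by (simp_all add: f_def q_def r_def)
  have g: "g 0 = t 0 + 2 * t 2" "g 1 = t 0 + 2 * t 2" "g 2 = t 1 + 2 * t 2" "g 3 = t 0 + t 2 + t 3"
    using t3 by (simp_all add: g_def q_def r_def transpose_def)
  have small: "t 0 \<le> t 1" "t 1 \<le> t 2" "t 2 \<le> t 3"
    using m by (auto intro!: mono)
  have big: "3 * t 3 \<le> g i" if "4 \<le> i" "i < m" for i
    using mono[of 3 i] that by (simp add: g_def q_def r_def transpose_def)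
  have "0 \<in> minimizers {..<m} g"
    proof (rule minimizers_lessThanI)
      show "g 0 \<le> g i" if "4 \<le> i" "i < m" for i
        using big[OF that] g small by linarith
    qed (use g small m in linarith)+
  moreover have "1 \<in> minimizers {..<m} g"
    proof (rule minimizers_lessThanI)
      show "g 1 \<le> g i" if "4 \<le> i" "i < m" for i
        using big[OF that] g small by linarith
    qed (use g small m in linarith)+
  \<comment> \<open>Both are then chosen before the swap too, where 0 has the same score but 1 has
    \<open>2 * t 1 + t 2\<close>.\<close>
  ultimately have "f 0 = f 1"
    using tied_minimizers eq by metis
  with f show ?thesis
    by simp
qed

text \<open>Alternatives \<open>n + 2\<close> and \<open>n + 3\<close> are transposed, while \<open>n\<close> ties with \<open>n + 2\<close>. The second
  ordering reverses the alternatives below \<open>n\<close> so that none of them scores lower.\<close>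

lemma next_gap:
  assumes n: "n + 3 < m"
    and mono: "\<And>i j. \<lbrakk>i \<le> j; j < m\<rbrakk> \<Longrightarrow> t i \<le> t j" and inv: "swap_invariant m t"
    and lin: "\<And>j. j \<le> n + 2 \<Longrightarrow> t j = c + real j * d"
  shows "t (n + 3) = c + real (n + 3) * d"
proof -
  \<comment> \<open>Alternative \<open>n\<close> gets positions \<open>n\<close>, 2, 1 and
    \<open>n + 2\<close> gets \<open>n + 2\<close>, 1, 0, both with sum \<open>n + 3\<close>. The
    swap moves \<open>n + 2\<close> down to \<open>n + 3\<close> in the first ordering and from 1 up
    to 0 in the second.\<close>
  define q :: "nat \<Rightarrow> nat" where "q = (\<lambda>j. if j < n then n + 2 - j else if j = n then 2
    else if j = n + 1 then n + 3 else if j = n + 2 then 1 else if j = n + 3 then 0 else j)"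
  define r :: "nat \<Rightarrow> nat" where "r = (\<lambda>j. if j < n then j + 2 else if j = n then 1
    else if j = n + 1 then n + 2 else if j = n + 2 then 0 else j)"
  define f where "f = (\<lambda>j. t j + t (q j) + t (r j))"
  define g where "g = (\<lambda>j. t (transpose (n + 2) (n + 3) j) + t (q (transpose (n + 2) (n + 3) j)) + t (r j))"
  have inj: "inj_on q {..<m}" "inj_on r {..<m}"
    by (rule inj_onI, simp add: q_def r_def split: if_splits)+
  have qm: "q j < m" and rm: "r j < m" if "j < m" for j
    using n that by (auto simp: q_def r_def)
  then have img: "q ` {..<m} \<subseteq> {..<m}" "r ` {..<m} \<subseteq> {..<m}"
    by auto
  have "q (n + 2) = Suc (q (n + 3))"
    by (simp add: q_def)
  then have eq: "minimizers {..<m} f = minimizers {..<m} g"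
    unfolding f_def g_def using n
    by (intro swap_invariantD[OF inv, where p = "\<lambda>j. j"] inj img) simp_all
  have d: "0 \<le> d"
    using mono[of 0 1] lin[of 0] lin[of 1] n by simp
  have f: "f (n + 2) = 3 * c + real (n + 3) * d" "f n = 3 * c + real (n + 3) * d"
    using lin[of 0] lin[of 1] lin[of 2] lin[of n] lin[of "n + 2"]
    by (simp_all add: f_def q_def r_def algebra_simps)
  have g: "g (n + 2) = 2 * c + t (n + 3)" "g n = f n"
    using lin[of 0] by (simp_all add: f_def g_def q_def r_def)
  have "3 * c + real (n + 3) * d \<le> f j" if j: "j < m" for j
  proof -
    \<comment> \<open>Weights beyond position \<open>n + 2\<close> are not yet known to be linear;
      capping positions there bounds them below by monotonicity.\<close>
    let ?b = "\<lambda>i. min i (n + 2)"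
    have le: "c + real (?b i) * d \<le> t i" if "i < m" for i
      using mono[of "?b i" i] lin[of "?b i"] that by simp
    have "3 * c + real (?b j + ?b (q j) + ?b (r j)) * d \<le> f j"
      using le[OF j] le[OF qm[OF j]] le[OF rm[OF j]]
      unfolding f_def of_nat_add distrib_right by linarith
    \<comment> \<open>For \<open>j < n\<close> the reversal makes this sum
      \<open>n + 4 + j\<close>.\<close>
    moreover have "n + 3 \<le> ?b j + ?b (q j) + ?b (r j)"
      by (simp add: q_def r_def)
    then have "real (n + 3) * d \<le> real (?b j + ?b (q j) + ?b (r j)) * d"
      using d by (intro mult_right_mono) (simp_all only: of_nat_le_iff)
    ultimately show ?thesis
      by linarith
  qed
  then have "n + 2 \<in> minimizers {..<m} f" "n \<in> minimizers {..<m} f"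
    using f n unfolding minimizers_def by simp_all
  then have "g (n + 2) = g n"
    using tied_minimizers eq by metis
  then show ?thesis
    using f g by linarith
qed

text \<open>Strong induction, as \<open>next_gap\<close> needs all earlier weights to be linear.
  Index 2 is \<open>first_gap_eq_second\<close>; \<open>next_gap\<close> takes over at index 3 with
  \<open>n = 0\<close>.\<close>

lemma swap_invariant_imp_arithmetic:
  assumes m: "3 < m" and mono: "\<And>i j. \<lbrakk>i \<le> j; j < m\<rbrakk> \<Longrightarrow> t i \<le> t j" and inv: "swap_invariant m t"
  shows "j < m \<Longrightarrow> t j = t 0 + real j * (t 1 - t 0)"
proof (induction j rule: less_induct)
  case (less j)
  have "j = 0 \<or> j = 1 \<or> j = 2 \<or> j = (j - 3) + 3"
    by linarith
  then consider "j = 0" | "j = 1" | "j = 2" | n where "j = n + 3"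
    by blast
  then show ?case
  proof cases
    case 3
    then show ?thesis
      using first_gap_eq_second[OF m mono inv] by simp
  next
    case (4 n)
    have lin: "t i = t 0 + real i * (t 1 - t 0)" if "i \<le> n + 2" for i
      by (rule less.IH) (use less.prems 4 that in linarith)+
    show ?thesis
      unfolding 4 by (rule next_gap[OF _ mono inv lin]) (use less.prems 4 in linarith)
  qed simp_all
qed

section \<open>From arithmetic weights to the Borda correspondence\<close>

lemma scoring_choice_affine:
  assumes X: "finite X" "\<forall>i\<in>N. u i \<in> orderings X"
    and lin: "\<And>j. j < card X \<Longrightarrow> s (Suc j) = a + real (Suc j) * d" and d: "0 < d"
  shows "scoring_choice X N s u = scoring_choice X N real u"
proof -
  \<comment> \<open>Since \<open>d > 0\<close>, this is one increasing function of the Borda score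
    for all \<open>x\<close>, so the minimizers agree.\<close>
  have "score X N s x u = real (card N) * a + d * score X N real x u" if x: "x \<in> X" for x
  proof -
    have "individual_score X s u i x = a + d * individual_score X real u i x" if i: "i \<in> N" for i
    proof -
      have "num_above X (u i) x < card X"
        using bij_betw_num_above[OF X(1)] X(2) x i unfolding bij_betw_def by blast
      then show ?thesis
        using X x i by (simp add: individual_score_eq lin mult.commute)
    qed
    then show ?thesis
      unfolding score_def by (simp add: sum.distrib sum_distrib_left)
  qed
  then show ?thesis
    using d unfolding scoring_choice_def by auto
qed

theorem theorem5:
  fixes X :: "'a set"
    and N :: "nat set"
    and G :: "(nat \<Rightarrow> 'a rel) \<Rightarrow> 'a set"
  assumes "finite X"
    and "card X > 3"
    and "N = {1, 2, 3}"
    and "is_scoring_correspondence X N G"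
    and "balanced X N G"
  shows "\<forall>u\<in>profiles X N. G u = borda X N u"
proof
  fix u assume u: "u \<in> profiles X N"
  obtain s where s: "scoring_system (card X) s" "\<forall>u\<in>profiles X N. G u = scoring_choice X N s u"
    using assms(4) unfolding is_scoring_correspondence_def by blast
  define t where "t = (\<lambda>j. s (Suc j))"
  have inv: "swap_invariant (card X) t"
    unfolding t_def using assms s(2) by (intro balanced_imp_swap_invariant) auto
  have mono: "t i \<le> t j" if "i \<le> j" "j < card X" for i j
    using s(1) that unfolding t_def scoring_system_def by auto
  define d where "d = t 1 - t 0"
  have lin: "t j = t 0 + real j * d" if "j < card X" for j
    using swap_invariant_imp_arithmetic[OF assms(2) mono inv that] unfolding d_def by simp
  obtain k l where kl: "k \<in> {1..card X}" "l \<in> {1..card X}" "s k \<noteq> s l"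
    using s(1) unfolding scoring_system_def by blast
  have "t (k - 1) = s k" "t (l - 1) = s l"
    using kl unfolding t_def by auto
  \<comment> \<open>With \<open>d = 0\<close> all weights would coincide.\<close>
  then have "d \<noteq> 0"
    using lin[of "k - 1"] lin[of "l - 1"] kl by auto
  moreover have "0 \<le> d"
    using mono[of 0 1] assms(2) unfolding d_def by simp
  ultimately have "0 < d"
    by simp
  have "scoring_choice X N s u = scoring_choice X N real u"
  proof (rule scoring_choice_affine)
    show "\<forall>i\<in>N. u i \<in> orderings X"
      using u unfolding profiles_def by auto
    \<comment> \<open>\<open>t 0\<close> is the weight of rank 1, so the intercept at rank 0 is
      \<open>t 0 - d\<close>.\<close>
    show "s (Suc j) = (t 0 - d) + real (Suc j) * d" if "j < card X" for j
      using lin[OF that] unfolding t_def by (simp add: algebra_simps)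
  qed (use assms(1) \<open>0 < d\<close> in auto)
  then show "G u = borda X N u"
    using s(2) u unfolding borda_def by simp
qed

end
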